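(* Let $\pi_1$, $\pi_2$ be two disjoint generators of $\mathcal{Q}^{+}(5,q)$, let $\mathcal{T}$ be a set of points of $\mathcal{Q}^{+}(5,q)$ disjoint from $\pi_{1}\cup\pi_{2}$, and let $\bm{c}'$ be the vector obtained from the characteristic vector of $\mathcal{T}$ by removing the entries corresponding to points of $\pi_{1}\cup\pi_{2}$. Let $\bm{A}'$ be the matrix obtained from the collinearity matrix $\bm{A}$ of $\mathcal{Q}^{+}(5,q)$ by deleting the rows and columns corresponding to points of $\pi_1\cup\pi_2$, and $\bm{j}'$ the all-ones vector of the corresponding length. Then $\mathcal{T}$ is an $x$-tight set of $\mathcal{Q}^{+}(5,q)$ if and only if \[ \left(\bm{c}' - \tfrac{x}{q^{2}-1}\bm{j}'\right)\bm{A}' = (q^{2}-1)\left(\bm{c}' - \tfrac{x}{q^{2}-1}\bm{j}'\right). \]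
   Context: $\mathcal{Q}^{+}(5,q)$ is the hyperbolic quadric in $\mathrm{PG}(5,q)$; generators are the planes on it. The collinearity matrix $\bm{A}$ is indexed by points of the quadric, with $\bm{A}_{\bm{p},\bm{r}}=1$ if $\bm{p}\neq\bm{r}$ lie on a common line of the quadric and $0$ otherwise. For a point $\bm{p}$, $\bm{p}^{\perp}$ denotes the set of points of the quadric collinear with $\bm{p}$, including $\bm{p}$. A point set $\mathcal{T}$ is an $x$-tight set if $|\bm{p}^{\perp}\cap\mathcal{T}|=x(q+1)+q^2\bm{c}_{\mathcal{T}}(\bm{p})$ for every point $\bm{p}$ of the quadric, where $\bm{c}_{\mathcal{T}}$ is the characteristic function of $\mathcal{T}$. *)

theory Defs
  imports "HOL-Analysis.Analysis"
begin

text \<open>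
  PG(5,q) is modelled on the vector space \<open>'a ^ 6\<close> over a finite field \<open>'a\<close> with
  \<open>q = CARD('a)\<close>. Points are the one-dimensional linear subspaces, and a projective
  subspace is identified with the set of its points.
\<close>

definition pg_points :: "(('a::field) ^ 'n) set set" where
  "pg_points = {p. vec.subspace p \<and> vec.dim p = 1}"

definition pg_subspaces :: "nat \<Rightarrow> (('a::field) ^ 'n) set set set" where
  "pg_subspaces k =
     {{p \<in> pg_points. p \<subseteq> U} | U. vec.subspace U \<and> vec.dim U = k + 1}"

abbreviation pg_lines :: "(('a::field) ^ 'n) set set set" where
  "pg_lines \<equiv> pg_subspaces 1"

abbreviation pg_planes :: "(('a::field) ^ 'n) set set set" where
  "pg_planes \<equiv> pg_subspaces 2"

text \<open>
  The canonical equation of the hyperbolic quadric, with coordinates indexed by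
  \<open>0, \<dots>, 5\<close>.
\<close>

definition hyperbolic_form :: "('a::field) ^ 6 \<Rightarrow> 'a" where
  "hyperbolic_form v = v $ 0 * v $ 1 + v $ 2 * v $ 3 + v $ 4 * v $ 5"

definition quadric :: "(('a::field) ^ 6) set set" where
  "quadric = {p \<in> pg_points. \<forall>v\<in>p. hyperbolic_form v = 0}"

definition quadric_lines :: "(('a::field) ^ 6) set set set" where
  "quadric_lines = {l \<in> pg_lines. l \<subseteq> quadric}"

definition generators :: "(('a::field) ^ 6) set set set" where
  "generators = {\<pi> \<in> pg_planes. \<pi> \<subseteq> quadric}"

definition on_common_line :: "(('a::field) ^ 6) set \<Rightarrow> ('a ^ 6) set \<Rightarrow> bool" where
  "on_common_line p r \<longleftrightarrow> (\<exists>l\<in>quadric_lines. p \<in> l \<and> r \<in> l)"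

definition perp :: "(('a::field) ^ 6) set \<Rightarrow> ('a ^ 6) set set" where
  "perp p = insert p {r \<in> quadric. on_common_line p r}"

definition tight_set :: "real \<Rightarrow> (('a::{field,finite}) ^ 6) set set \<Rightarrow> bool" where
  "tight_set x T \<longleftrightarrow> T \<subseteq> quadric \<and>
     (\<forall>p\<in>quadric. real (card (perp p \<inter> T)) =
        x * (real CARD('a) + 1) + (real CARD('a))\<^sup>2 * indicator T p)"

text \<open>
  Real vectors and matrices with index set \<open>I\<close> are functions that are extensional on
  \<open>I\<close>, so that equality of vectors is equality of the entries indexed by \<open>I\<close>.
  Deleting entries means restricting to the remaining indices.
\<close>

definition restrict_matrix :: "'i set \<Rightarrow> ('i \<Rightarrow> 'i \<Rightarrow> real) \<Rightarrow> 'i \<Rightarrow> 'i \<Rightarrow> real" where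
  "restrict_matrix I M = (\<lambda>i\<in>I. \<lambda>j\<in>I. M i j)"

definition row_mult :: "'i set \<Rightarrow> ('i \<Rightarrow> real) \<Rightarrow> ('i \<Rightarrow> 'i \<Rightarrow> real) \<Rightarrow> 'i \<Rightarrow> real" where
  "row_mult I v M = (\<lambda>j\<in>I. \<Sum>i\<in>I. v i * M i j)"

definition vec_diff :: "'i set \<Rightarrow> ('i \<Rightarrow> real) \<Rightarrow> ('i \<Rightarrow> real) \<Rightarrow> 'i \<Rightarrow> real" where
  "vec_diff I v w = (\<lambda>i\<in>I. v i - w i)"

definition vec_scale :: "'i set \<Rightarrow> real \<Rightarrow> ('i \<Rightarrow> real) \<Rightarrow> 'i \<Rightarrow> real" where
  "vec_scale I a v = (\<lambda>i\<in>I. a * v i)"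

definition all_ones :: "'i set \<Rightarrow> 'i \<Rightarrow> real" where
  "all_ones I = (\<lambda>i\<in>I. 1)"

definition char_vec :: "(('a::field) ^ 6) set set \<Rightarrow> ('a ^ 6) set \<Rightarrow> real" where
  "char_vec T = (\<lambda>p\<in>quadric. indicator T p)"

definition collinearity_matrix :: "(('a::field) ^ 6) set \<Rightarrow> ('a ^ 6) set \<Rightarrow> real" where
  "collinearity_matrix =
     (\<lambda>p\<in>quadric. \<lambda>r\<in>quadric. if p \<noteq> r \<and> on_common_line p r then 1 else 0)"

end

theory Submission imports Defs begin

text \<open>
  The points off the two generators each see \<open>(q\<^sup>2 - 1)(q + 2)\<close> other such points, so the
  eigenvector equation says exactly that the tightness condition holds at the points off
  \<open>\<pi>\<^sub>1 \<union> \<pi>\<^sub>2\<close>. Let \<open>w\<close> be the defect of the tightness condition, a function supported on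
  \<open>\<pi>\<^sub>1 \<union> \<pi>\<^sub>2\<close>. Summing the condition over the points off \<open>\<pi>\<^sub>1 \<union> \<pi>\<^sub>2\<close> gives
  \<open>|T| = x(q\<^sup>2 + q + 1)\<close>, and since a point outside a generator is collinear with exactly
  \<open>q + 1\<close> of its points, \<open>w\<close> then sums to zero over every generator. Applied to the planes that
  meet one of \<open>\<pi>\<^sub>1\<close>, \<open>\<pi>\<^sub>2\<close> in a point and the other in a line, this yields \<open>w = q w\<close>
  on \<open>\<pi>\<^sub>1\<close> and on \<open>\<pi>\<^sub>2\<close>, hence \<open>w = 0\<close>.
\<close>

section \<open>Subspaces over a finite field\<close>

lemma card_field_gt_1: "CARD('a::{field,finite}) > 1"
proof -
  have "card {0, 1::'a} \<le> CARD('a)"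
    by (rule card_mono) auto
  then show ?thesis by simp
qed

text \<open>The map \<open>(k, y)\<close> to \<open>k *s b + y\<close> is a bijection from pairs of
  a scalar and a vector of the old span: two representations with different scalars could be solved
  for \<open>b\<close>, which would put \<open>b\<close> in the old span.\<close>

lemma card_span_insert:
  fixes S :: "(('a::{field,finite}) ^ 'n) set"
  assumes "b \<notin> vec.span S"
  shows "card (vec.span (insert b S)) = CARD('a) * card (vec.span S)"
proof -
  let ?f = "\<lambda>(k::'a, y). k *s b + y"
  have "inj_on ?f (UNIV \<times> vec.span S)"
  proof (rule inj_onI, clarify)
    fix k l :: 'a and y z
    assume yz: "y \<in> vec.span S" "z \<in> vec.span S" and eq: "k *s b + y = l *s b + z"
    have diff: "(k - l) *s b = z - y"
      using eq by (simp add: vec.scale_left_diff_distrib algebra_simps)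
    have "k = l"
    proof (rule ccontr)
      assume "k \<noteq> l"
      then have "b = inverse (k - l) *s ((k - l) *s b)"
        by (metis left_inverse right_minus_eq vec.scale_one vec.scale_scale)
      also have "\<dots> \<in> vec.span S"
        using diff yz by (simp add: vec.span_diff vec.span_scale)
      finally show False using assms by simp
    qed
    then show "k = l \<and> y = z" using eq by simp
  qed
  moreover have "?f ` (UNIV \<times> vec.span S) = vec.span (insert b S)"
  proof (intro set_eqI iffI)
    fix v assume "v \<in> vec.span (insert b S)"
    then obtain k where "v - k *s b \<in> vec.span S"
      by (auto simp: vec.span_insert)
    then have "?f (k, v - k *s b) \<in> ?f ` (UNIV \<times> vec.span S)" by blast
    then show "v \<in> ?f ` (UNIV \<times> vec.span S)" by simp
  qed (auto intro!: vec.span_add vec.span_scale intro: vec.span_base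
      subsetD[OF vec.span_mono[OF subset_insertI]])
  ultimately have "card (vec.span (insert b S)) = card ((UNIV::'a set) \<times> vec.span S)"
    by (metis card_image)
  then show ?thesis by (simp add: card_cartesian_product)
qed

lemma card_span_independent:
  fixes B :: "(('a::{field,finite}) ^ 'n) set"
  assumes "vec.independent B"
  shows "card (vec.span B) = CARD('a) ^ card B"
proof -
  have "finite B" by simp
  then show ?thesis using assms
  proof (induction B)
    case (insert b B)
    then show ?case
      using card_span_insert[of b B] by (simp add: vec.independent_insert)
  qed simp
qed

lemma card_subspace:
  fixes U :: "(('a::{field,finite}) ^ 'n) set"
  assumes "vec.subspace U"
  shows "card U = CARD('a) ^ vec.dim U"
proof -
  obtain B where B: "B \<subseteq> U" "vec.independent B" "U \<subseteq> vec.span B" "card B = vec.dim U"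
    using vec.basis_exists by blast
  have "vec.span B = U"
    using B assms by (simp add: vec.span_minimal subset_antisym)
  then show ?thesis using B card_span_independent by metis
qed

text \<open>Scale \<open>u\<close> to a vector \<open>e\<close> with \<open>f e = 1\<close>.
  Translation by multiples of \<open>e\<close> carries any fibre of \<open>f\<close> on
  \<open>U\<close> to any other, so the q fibres have equal size. Values c other than 0 matter for
  the inhomogeneous conditions in \<open>card_perp\<close>.\<close>

lemma card_linear_fibre:
  fixes U :: "(('a::{field,finite}) ^ 'n) set" and f :: "'a ^ 'n \<Rightarrow> 'a"
  assumes U: "vec.subspace U"
    and add: "\<And>v w. f (v + w) = f v + f w" and scale: "\<And>k v. f (k *s v) = k * f v"
    and "u \<in> U" "f u \<noteq> 0"
  shows "CARD('a) * card {v \<in> U. f v = c} = card U"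
proof -
  define e where "e = inverse (f u) *s u"
  have e: "e \<in> U" "f e = 1"
    using assms by (simp_all add: e_def vec.subspace_scale)
  have fibre: "card {v \<in> U. f v = d} = card {v \<in> U. f v = c}" for d
  proof (rule bij_betw_same_card)
    define a where "a = c - d"
    then have "c = d + a" by simp
    moreover have "f (v - a *s e) = f v - a" for v
      using add[of "v - a *s e" "a *s e"] e by (simp add: scale)
    ultimately show "bij_betw (\<lambda>v. v + a *s e) {v \<in> U. f v = d} {v \<in> U. f v = c}"
      by (intro bij_betw_byWitness[where f' = "\<lambda>v. v - a *s e"])
        (use U e in
          \<open>auto simp: add scale vec.subspace_add vec.subspace_scale vec.subspace_diff\<close>)
  qed
  have "U = (\<Union>d\<in>UNIV. {v \<in> U. f v = d})" by auto
  then have "card U = card (\<Union>d\<in>UNIV. {v \<in> U. f v = d})" by simp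
  also have "\<dots> = (\<Sum>d\<in>UNIV. card {v \<in> U. f v = d})"
    by (rule card_UN_disjoint) auto
  also have "\<dots> = (\<Sum>d\<in>(UNIV :: 'a set). card {v \<in> U. f v = c})"
    by (rule sum.cong[OF refl fibre])
  finally show ?thesis by simp
qed

section \<open>Counting the projective points contained in a set of vectors\<close>

definition points_in :: "(('a::field) ^ 'n) set \<Rightarrow> ('a ^ 'n) set set" where
  "points_in X = {p \<in> pg_points. p \<subseteq> X}"

lemma pg_pointE:
  assumes "p \<in> pg_points"
  obtains u where "u \<noteq> 0" "p = vec.span {u}"
proof -
  have p: "vec.subspace p" "vec.dim p = 1"
    using assms by (auto simp: pg_points_def)
  obtain B where B: "B \<subseteq> p" "vec.independent B" "p \<subseteq> vec.span B" "card B = vec.dim p"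
    using vec.basis_exists by blast
  then obtain u where "B = {u}" using p by (auto simp: card_1_singleton_iff)
  moreover have "vec.span B = p"
    using B p by (simp add: vec.span_minimal subset_antisym)
  ultimately show thesis using that B by auto
qed

lemma span_in_pg_points: "u \<noteq> 0 \<Longrightarrow> vec.span {u} \<in> pg_points"
  by (simp add: pg_points_def)

lemma pg_point_eq_span:
  assumes "p \<in> pg_points" "v \<in> p" "v \<noteq> 0"
  shows "p = vec.span {v}"
proof -
  obtain u where u: "u \<noteq> 0" "p = vec.span {u}" using assms by (auto elim: pg_pointE)
  then obtain k where k: "v = k *s u" using assms by (auto simp: vec.span_singleton)
  with assms have "k \<noteq> 0" by auto
  then have "u = inverse k *s v" by (simp add: k vec.scale_scale)
  then have "u \<in> vec.span {v}" by (metis vec.span_base vec.span_scale singletonI)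
  then show ?thesis using u assms by (simp add: vec.span_minimal subset_antisym)
qed

text \<open>The points of \<open>X\<close> partition its nonzero vectors into classes of size q - 1.
  \<open>X\<close> is a cone rather than a subspace so that the set of singular vectors and its
  intersection with a hyperplane are covered.\<close>

lemma card_points_in:
  fixes X :: "(('a::{field,finite}) ^ 'n) set"
  assumes "0 \<in> X" and scale: "\<And>k v. v \<in> X \<Longrightarrow> k *s v \<in> X"
  shows "(real CARD('a) - 1) * real (card (points_in X)) = real (card X) - 1"
proof -
  have "X - {0} = (\<Union>p\<in>points_in X. p - {0})"
  proof (intro set_eqI iffI)
    fix v assume v: "v \<in> X - {0}"
    then have "vec.span {v} \<in> points_in X"
      using scale span_in_pg_points[of v] by (auto simp: points_in_def vec.span_singleton)
    moreover have "v \<in> vec.span {v}" by (simp add: vec.span_base)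
    ultimately show "v \<in> (\<Union>p\<in>points_in X. p - {0})" using v by blast
  qed (auto simp: points_in_def)
  then have "card (X - {0}) = card (\<Union>p\<in>points_in X. p - {0})" by simp
  also have "\<dots> = (\<Sum>p\<in>points_in X. card (p - {0}))"
    by (rule card_UN_disjoint) (auto simp: points_in_def dest: pg_point_eq_span)
  also have "\<dots> = (\<Sum>p\<in>points_in X. CARD('a) - 1)"
  proof (rule sum.cong)
    fix p assume "p \<in> points_in X"
    then have "vec.subspace p" "vec.dim p = 1" by (auto simp: points_in_def pg_points_def)
    then show "card (p - {0}) = CARD('a) - 1"
      using card_subspace[of p] by (simp add: card_Diff_singleton vec.subspace_0)
  qed simp
  finally have "card X - 1 = card (points_in X) * (CARD('a) - 1)"
    using \<open>0 \<in> X\<close> by (simp add: card_Diff_singleton)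
  then have "real (card X - 1) = real (card (points_in X)) * real (CARD('a) - 1)"
    by (metis of_nat_mult)
  moreover have "1 \<le> card X"
    using \<open>0 \<in> X\<close> by (metis One_nat_def Suc_leI card_gt_0_iff empty_iff finite)
  moreover have "1 \<le> CARD('a)" using card_field_gt_1[where 'a='a] by simp
  ultimately show ?thesis by (simp add: of_nat_diff)
qed

lemma card_points_in_subspace:
  fixes U :: "(('a::{field,finite}) ^ 'n) set"
  assumes "vec.subspace U"
  shows "(real CARD('a) - 1) * real (card (points_in U)) = real CARD('a) ^ vec.dim U - 1"
  using card_points_in[of U] card_subspace[OF assms] assms
  by (simp add: vec.subspace_0 vec.subspace_scale)

section \<open>The polar form\<close>

text \<open>The bilinear form B with Q(v + w) = Q(v) + Q(w) + B(v, w). It is written out in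
  coordinates without division by 2, so characteristic 2 is included.\<close>

definition polar_form :: "('a::field) ^ 6 \<Rightarrow> 'a ^ 6 \<Rightarrow> 'a" where
  "polar_form v w = v $ 0 * w $ 1 + v $ 1 * w $ 0 + v $ 2 * w $ 3 + v $ 3 * w $ 2
     + v $ 4 * w $ 5 + v $ 5 * w $ 4"

lemma hyperbolic_form_add:
  "hyperbolic_form (v + w) = hyperbolic_form v + hyperbolic_form w + polar_form v w"
  by (simp add: hyperbolic_form_def polar_form_def algebra_simps)

lemma hyperbolic_form_scale: "hyperbolic_form (k *s v) = k * k * hyperbolic_form v"
  by (simp add: hyperbolic_form_def algebra_simps)

lemma hyperbolic_form_0 [simp]: "hyperbolic_form 0 = 0"
  by (simp add: hyperbolic_form_def)

lemma polar_form_simps: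
  "polar_form (u + v) w = polar_form u w + polar_form v w"
  "polar_form u (v + w) = polar_form u v + polar_form u w"
  "polar_form (k *s u) v = k * polar_form u v"
  "polar_form u (k *s v) = k * polar_form u v"
  "polar_form 0 v = 0" "polar_form v 0 = 0"
  by (simp_all add: polar_form_def algebra_simps)

lemma polar_form_commute: "polar_form v w = polar_form w v"
  by (simp add: polar_form_def algebra_simps)

lemma exhaust_6:
  fixes i :: 6
  shows "i = 0 \<or> i = 1 \<or> i = 2 \<or> i = 3 \<or> i = 4 \<or> i = 5"
proof (induct i)
  case (of_int z)
  then have "0 \<le> z" and "z < 6" by simp_all
  then have "z = 0 \<or> z = 1 \<or> z = 2 \<or> z = 3 \<or> z = 4 \<or> z = 5" by arith
  then show ?case by auto
qed

text \<open>Pairing with the six standard basis vectors reads off the coordinates of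
  \<open>w\<close>, exchanged in pairs.\<close>

lemma polar_form_nondegenerate:
  assumes "w \<noteq> (0 :: ('a::field) ^ 6)"
  obtains v where "polar_form w v \<noteq> 0"
proof -
  have axis: "polar_form w (axis 0 1) = w $ 1" "polar_form w (axis 1 1) = w $ 0"
    "polar_form w (axis 2 1) = w $ 3" "polar_form w (axis 3 1) = w $ 2"
    "polar_form w (axis 4 1) = w $ 5" "polar_form w (axis 5 1) = w $ 4"
    by (simp_all add: polar_form_def axis_def)
  obtain i where "w $ i \<noteq> 0" using assms by (auto simp: vec_eq_iff)
  then show thesis using exhaust_6[of i] that axis by metis
qed

definition orth :: "(('a::field) ^ 6) set \<Rightarrow> ('a ^ 6) set" where
  "orth X = {v. \<forall>u\<in>X. polar_form u v = 0}"

lemma orth_insert: "orth (insert u X) = orth {u} \<inter> orth X"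
  by (auto simp: orth_def)

lemma orth_antimono: "X \<subseteq> Y \<Longrightarrow> orth Y \<subseteq> orth X"
  by (auto simp: orth_def)

lemma subspace_orth [simp]: "vec.subspace (orth X)"
  by (auto simp: vec.subspace_def orth_def polar_form_simps)

lemma subset_orth_commute: "X \<subseteq> orth Y \<longleftrightarrow> Y \<subseteq> orth X"
  unfolding orth_def subset_iff mem_Collect_eq by (metis polar_form_commute)

lemma orth_span [simp]: "orth (vec.span X) = orth X"
proof
  show "orth (vec.span X) \<subseteq> orth X"
    using vec.span_superset[of X] by (auto simp: orth_def)
  \<comment> \<open>The double complement is a subspace containing \<open>X\<close>, hence contains
    its span; symmetry of orthogonality then reverses the inclusion.\<close>
  have "X \<subseteq> orth (orth X)" by (auto simp: orth_def polar_form_commute)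
  then have "vec.span X \<subseteq> orth (orth X)" by (simp add: vec.span_minimal)
  then show "orth X \<subseteq> orth (vec.span X)" by (rule subset_orth_commute[THEN iffD1])
qed

lemma sum_if_const:
  fixes c :: real
  assumes "finite A"
  shows "(\<Sum>x\<in>A. if P x then c else 0) = c * real (card {x \<in> A. P x})"
  using sum.inter_filter[OF assms, of "\<lambda>_. c" P] by (simp add: mult.commute)

text \<open>Counting the orthogonal pairs in \<open>W \<times> V\<close> in both orders.\<close>

lemma card_orth_subspace:
  fixes W :: "(('a::{field,finite}) ^ 6) set"
  assumes W: "vec.subspace W"
  shows "card W * card (orth W) = CARD('a) ^ 6"
proof -
  let ?V = "UNIV :: ('a ^ 6) set"
  let ?q = "real CARD('a)"
  define m n N where "m = real (card ?V)" and "n = real (card W)" and "N = real (card (orth W))"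
  have m: "m = real (CARD('a) ^ 6)"
    by (simp add: m_def)
  \<comment> \<open>Each orthogonal pair gets weight q. A nonzero \<open>w\<close> has m/q
    orthogonal vectors and so contributes exactly m, which avoids division.\<close>
  have "(\<Sum>w\<in>W. \<Sum>v\<in>?V. if polar_form w v = 0 then ?q else 0)
      = (\<Sum>w\<in>W. if w = 0 then ?q * m else m)"
  proof (rule sum.cong)
    fix w assume "w \<in> W"
    show "(\<Sum>v\<in>?V. if polar_form w v = 0 then ?q else 0) = (if w = 0 then ?q * m else m)"
    proof (cases "w = 0")
      case False
      then obtain u where "polar_form w u \<noteq> 0" by (rule polar_form_nondegenerate)
      then have "CARD('a) * card {v \<in> ?V. polar_form w v = 0} = card ?V"
        by (intro card_linear_fibre[where u = u]) (simp_all add: polar_form_simps)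
      then have "?q * real (card {v \<in> ?V. polar_form w v = 0}) = m"
        unfolding m_def by (simp only: of_nat_mult[symmetric])
      then show ?thesis using False by (simp add: sum_if_const)
    qed (simp add: polar_form_simps m_def)
  qed simp
  also have "\<dots> = (\<Sum>w\<in>W. m + (if w = 0 then (?q - 1) * m else 0))"
    by (rule sum.cong) (simp_all add: algebra_simps)
  also have "\<dots> = m * n + (?q - 1) * m"
    using W by (simp add: sum.distrib n_def vec.subspace_0)
  finally have 1: "(\<Sum>w\<in>W. \<Sum>v\<in>?V. if polar_form w v = 0 then ?q else 0) = m * n + (?q - 1) * m" .
  have "(\<Sum>v\<in>?V. \<Sum>w\<in>W. if polar_form w v = 0 then ?q else 0)
      = (\<Sum>v\<in>?V. if v \<in> orth W then ?q * n else n)"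
  proof (rule sum.cong)
    fix v :: "'a ^ 6"
    show "(\<Sum>w\<in>W. if polar_form w v = 0 then ?q else 0) = (if v \<in> orth W then ?q * n else n)"
    proof (cases "v \<in> orth W")
      case False
      then obtain u where "u \<in> W" "polar_form u v \<noteq> 0" by (auto simp: orth_def)
      then have "CARD('a) * card {w \<in> W. polar_form w v = 0} = card W"
        using W by (intro card_linear_fibre[where u = u]) (simp_all add: polar_form_simps)
      then have "?q * real (card {w \<in> W. polar_form w v = 0}) = n"
        unfolding n_def by (simp only: of_nat_mult[symmetric])
      then show ?thesis using False by (simp add: sum_if_const)
    qed (simp add: orth_def n_def)
  qed simp
  also have "\<dots> = (\<Sum>v\<in>?V. n + (if v \<in> orth W then (?q - 1) * n else 0))"
    by (rule sum.cong) (simp_all add: algebra_simps)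
  also have "\<dots> = m * n + N * (?q - 1) * n"
    by (simp add: sum.distrib m_def N_def sum_if_const)
  \<comment> \<open>Both totals contain the term \<open>m * n\<close>; what remains compares
    \<open>(?q - 1) * m\<close> with \<open>(?q - 1) * n * N\<close>.\<close>
  finally have "m * n + (?q - 1) * m = m * n + N * (?q - 1) * n"
    using 1 sum.swap[of "\<lambda>w v. if polar_form w v = 0 then ?q else 0" ?V W] by argo
  then have "(?q - 1) * (n * N) = (?q - 1) * m" by (simp add: algebra_simps)
  moreover have "?q - 1 \<noteq> 0" using card_field_gt_1[where 'a='a] by simp
  ultimately have "n * N = m" by simp
  then show ?thesis using m unfolding n_def N_def by (metis of_nat_eq_iff of_nat_mult)
qed

text \<open>Compare exponents of q in \<open>card_orth_subspace\<close> for the span of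
  \<open>X\<close>. Allowing any set \<open>X\<close> makes the formula directly applicable to
  generating sets such as \<open>insert u U\<close>.\<close>

lemma dim_orth:
  fixes X :: "(('a::{field,finite}) ^ 6) set"
  shows "vec.dim X + vec.dim (orth X) = 6"
proof -
  have "CARD('a) ^ (vec.dim X + vec.dim (orth X)) = CARD('a) ^ 6"
    using card_orth_subspace[of "vec.span X"] card_subspace[of "vec.span X"]
      card_subspace[of "orth X"] by (simp add: power_add)
  then show ?thesis using card_field_gt_1[where 'a='a] power_inject_exp by blast
qed


section \<open>Points of the quadric\<close>

lemma quadric_eq: "quadric = points_in {v. hyperbolic_form v = 0}"
  by (auto simp: quadric_def points_in_def)

lemma points_in_Int: "points_in (X \<inter> Y) = points_in X \<inter> points_in Y"
  by (auto simp: points_in_def)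

lemma points_in_pg_point:
  assumes "p \<in> pg_points"
  shows "points_in p = {p}"
proof -
  have "r = p" if r: "r \<in> pg_points" "r \<subseteq> p" for r
  proof -
    obtain u where "u \<noteq> 0" "r = vec.span {u}" using r by (auto elim: pg_pointE)
    moreover from this have "u \<in> p" using r vec.span_base[of u "{u}"] by auto
    ultimately show ?thesis using pg_point_eq_span[OF assms] by simp
  qed
  then show ?thesis using assms by (auto simp: points_in_def)
qed

lemma points_in_subset_quadric_iff:
  assumes "vec.subspace U"
  shows "points_in U \<subseteq> quadric \<longleftrightarrow> (\<forall>v\<in>U. hyperbolic_form v = 0)"
proof
  assume sub: "points_in U \<subseteq> quadric"
  show "\<forall>v\<in>U. hyperbolic_form v = 0"
  proof
    fix v assume "v \<in> U"
    show "hyperbolic_form v = 0"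
    proof (cases "v = 0")
      case False
      have "vec.span {v} \<in> points_in U"
        using False \<open>v \<in> U\<close> assms
        by (simp add: points_in_def span_in_pg_points vec.span_minimal)
      then have "vec.span {v} \<in> quadric" using sub by blast
      then show ?thesis using vec.span_base[of v "{v}"] by (simp add: quadric_def)
    qed simp
  qed
qed (auto simp: quadric_def points_in_def)

text \<open>The vector space form of a projective subspace lying on the quadric. It is phrased with
  the quadratic form, since in characteristic 2 the vanishing of the polar form on U does not force
  the quadratic form to vanish.\<close>

definition totally_singular :: "(('a::field) ^ 6) set \<Rightarrow> bool" where
  "totally_singular U \<longleftrightarrow> vec.subspace U \<and> (\<forall>v\<in>U. hyperbolic_form v = 0)"

lemma totally_singular_subset_orth:
  assumes "totally_singular U"
  shows "U \<subseteq> orth U"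
proof -
  have "polar_form u v = 0" if "u \<in> U" "v \<in> U" for u v
    using assms that hyperbolic_form_add[of u v] vec.subspace_add[of U u v]
    by (simp add: totally_singular_def)
  then show ?thesis by (auto simp: orth_def)
qed

text \<open>A vector of the new span is y + k v with y in \<open>U\<close>, and Q(y + k v) = Q(y) +
  k^2 Q(v) + k B(y, v), where every term is zero.\<close>

lemma totally_singular_insert:
  assumes U: "totally_singular U" and v: "hyperbolic_form v = 0" "v \<in> orth U"
  shows "totally_singular (vec.span (insert v U))"
  unfolding totally_singular_def
proof (intro conjI ballI)
  fix w assume "w \<in> vec.span (insert v U)"
  then obtain k where "w - k *s v \<in> vec.span U" by (auto simp: vec.span_insert)
  then have "w - k *s v \<in> U" using U by (metis totally_singular_def vec.span_eq_iff)
  moreover from this have "polar_form (w - k *s v) (k *s v) = 0"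
    using v by (simp only: orth_def polar_form_simps) simp
  ultimately have "hyperbolic_form ((w - k *s v) + k *s v) = 0"
    using U v by (simp only: hyperbolic_form_add hyperbolic_form_scale totally_singular_def) simp
  then show "hyperbolic_form w = 0" by simp
qed simp

lemma quadric_totally_singular: "p \<in> quadric \<Longrightarrow> totally_singular p"
  by (auto simp: quadric_def totally_singular_def pg_points_def)

lemma quadric_pg_points: "p \<in> quadric \<Longrightarrow> p \<in> pg_points"
  by (simp add: quadric_def)

lemma generatorE:
  assumes "\<pi> \<in> generators"
  obtains U where "totally_singular U" "vec.dim U = 3" "\<pi> = points_in U"
proof -
  obtain U where U: "vec.subspace U" "vec.dim U = 3" "\<pi> = points_in U"
    using assms by (auto simp: generators_def pg_subspaces_def points_in_def)
  moreover have "points_in U \<subseteq> quadric" using assms U by (simp add: generators_def)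
  ultimately show thesis
    using that points_in_subset_quadric_iff[of U] by (simp add: totally_singular_def)
qed

lemma points_in_totally_singular: "totally_singular U \<Longrightarrow> points_in U \<subseteq> quadric"
  by (simp add: points_in_subset_quadric_iff totally_singular_def)

text \<open>This turns collinearity into linear algebra. A line of the quadric is totally singular
  and therefore orthogonal to itself; conversely, two distinct orthogonal singular points span a
  totally singular 2-space, which is a common line.\<close>

lemma perp_eq:
  assumes p: "p \<in> quadric"
  shows "perp p = quadric \<inter> points_in (orth p)"
proof (intro set_eqI iffI)
  fix r assume r: "r \<in> perp p"
  show "r \<in> quadric \<inter> points_in (orth p)"
  proof (cases "r = p")
    case True
    then show ?thesis
      using p totally_singular_subset_orth[OF quadric_totally_singular[OF p]]
      by (simp add: points_in_def quadric_pg_points)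
  next
    case False
    then obtain l where l: "l \<in> quadric_lines" "p \<in> l" "r \<in> l" and rq: "r \<in> quadric"
      using r by (auto simp: perp_def on_common_line_def)
    then obtain U where U: "vec.subspace U" "l = points_in U"
      by (auto simp: quadric_lines_def pg_subspaces_def points_in_def)
    then have "totally_singular U"
      using l points_in_subset_quadric_iff[of U] by (simp add: quadric_lines_def totally_singular_def)
    then have "U \<subseteq> orth U" by (rule totally_singular_subset_orth)
    moreover have "r \<subseteq> U" "p \<subseteq> U" using l U by (auto simp: points_in_def)
    ultimately have "r \<subseteq> orth p" using orth_antimono[of p U] by blast
    then show ?thesis using rq by (simp add: points_in_def quadric_pg_points)
  qed
next
  fix r assume "r \<in> quadric \<inter> points_in (orth p)"
  then have r: "r \<in> quadric" "r \<subseteq> orth p" by (auto simp: points_in_def)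
  show "r \<in> perp p"
  proof (cases "r = p")
    case False
    obtain u where u: "u \<noteq> 0" "p = vec.span {u}" using p by (metis quadric_pg_points pg_pointE)
    obtain v where v: "v \<noteq> 0" "r = vec.span {v}" using r by (metis quadric_pg_points pg_pointE)
    have vp: "v \<notin> p"
      using False pg_point_eq_span[of p v] p v by (auto simp: quadric_pg_points)
    have vr: "v \<in> r" using v by (simp add: vec.span_base)
    define U where "U = vec.span (insert v p)"
    have "totally_singular U"
      unfolding U_def using r vr quadric_totally_singular[OF r(1)]
      by (intro totally_singular_insert quadric_totally_singular[OF p])
        (auto simp: totally_singular_def)
    then have U: "vec.subspace U" "points_in U \<subseteq> quadric"
      by (simp_all add: totally_singular_def points_in_subset_quadric_iff)
    have "vec.span p = p" using u by simp
    then have "vec.dim (insert v p) = vec.dim p + 1"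
      using vp by (simp add: vec.dim_insert del: vec.span_eq_iff)
    then have "vec.dim U = 2"
      using quadric_pg_points[OF p] by (simp add: U_def pg_points_def)
    then have "points_in U \<in> quadric_lines"
      using U by (auto simp: quadric_lines_def pg_subspaces_def points_in_def)
    moreover have "p \<subseteq> U" "v \<in> U"
      unfolding U_def by (auto intro: vec.span_base)
    then have "p \<in> points_in U" "r \<in> points_in U"
      using p r v U by (simp_all add: points_in_def quadric_pg_points vec.span_minimal)
    ultimately show ?thesis
      using r by (auto simp: perp_def on_common_line_def)
  qed (simp add: perp_def)
qed

lemma perp_commute:
  assumes "p \<in> quadric" "r \<in> quadric"
  shows "r \<in> perp p \<longleftrightarrow> p \<in> perp r"
  using assms subset_orth_commute[of r p]
  by (simp add: perp_eq points_in_def quadric_pg_points)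

section \<open>How the perp of a point meets a generator\<close>

lemma card_points_in_dim:
  fixes U :: "(('a::{field,finite}) ^ 'n) set"
  assumes "vec.subspace U"
  shows "real (card (points_in U)) = (\<Sum>i<vec.dim U. real CARD('a) ^ i)"
proof -
  have "(real CARD('a) - 1) * real (card (points_in U))
      = (real CARD('a) - 1) * (\<Sum>i<vec.dim U. real CARD('a) ^ i)"
    using card_points_in_subspace[OF assms] by (simp add: power_diff_1_eq)
  then show ?thesis using card_field_gt_1[where 'a='a] by simp
qed

text \<open>\<open>U\<close> lies in its orthogonal complement, and both have dimension 3 because 3
  + 3 = 6.\<close>

lemma orth_generator:
  fixes U :: "(('a::{field,finite}) ^ 6) set"
  assumes "totally_singular U" "vec.dim U = 3"
  shows "orth U = U"
  using totally_singular_subset_orth[of U] dim_orth[of U] assms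
  by (intro vec.subspace_dim_equal[symmetric]) (simp_all add: totally_singular_def)

lemma perp_Int_generator:
  fixes U :: "(('a::{field,finite}) ^ 6) set"
  assumes "totally_singular U" "vec.dim U = 3" "vec.span {u} \<in> quadric"
  shows "perp (vec.span {u}) \<inter> points_in U = points_in (orth (insert u U))"
proof -
  have "orth (insert u U) = orth {u} \<inter> U"
    using orth_insert[of u U] orth_generator[of U] assms by simp
  then show ?thesis
    using assms points_in_totally_singular[of U] by (auto simp: perp_eq points_in_Int)
qed

text \<open>The intersection is the complement of \<open>insert v U\<close>: all of \<open>U\<close>
  if the point lies on the generator, otherwise of dimension 6 - 4 = 2, a line with q + 1 points.
  Written with the indicator, the formula says that a generator is a 1-tight set.\<close>

lemma card_perp_generator:
  fixes U :: "(('a::{field,finite}) ^ 6) set"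
  assumes U: "totally_singular U" "vec.dim U = 3" and r: "r \<in> quadric"
  shows "real (card (perp r \<inter> points_in U))
    = real CARD('a) + 1 + (real CARD('a))\<^sup>2 * indicator (points_in U) r"
proof -
  obtain v where v: "v \<noteq> 0" "r = vec.span {v}" using r by (metis quadric_pg_points pg_pointE)
  have sp: "vec.span U = U" using U by (simp add: totally_singular_def vec.span_eq_iff)
  have "r \<subseteq> U \<longleftrightarrow> v \<in> U"
    using v U vec.span_base[of v "{v}"] vec.span_minimal[of "{v}" U]
    by (auto simp: totally_singular_def)
  then have rU: "r \<in> points_in U \<longleftrightarrow> v \<in> U"
    using r by (simp add: points_in_def quadric_pg_points)
  have "vec.dim (insert v U) + vec.dim (orth (insert v U)) = 6" by (rule dim_orth)
  then have "vec.dim (orth (insert v U)) = (if v \<in> U then 3 else 2)"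
    using U sp by (simp add: vec.dim_insert split: if_splits del: vec.span_eq_iff)
  moreover have "real (card (perp r \<inter> points_in U))
      = (\<Sum>i<vec.dim (orth (insert v U)). real CARD('a) ^ i)"
    using perp_Int_generator[OF U, of v] r v by (simp add: card_points_in_dim)
  ultimately show ?thesis
    by (cases "v \<in> U") (simp_all add: rU numeral_2_eq_2 numeral_3_eq_3)
qed

section \<open>Double counting of collinear pairs\<close>

lemma card_Int_eq_sum:
  assumes "finite X"
  shows "real (card (A \<inter> X)) = (\<Sum>r\<in>X. indicat_real A r)"
proof -
  have "A \<inter> X = {r \<in> X. r \<in> A}" by blast
  then show ?thesis using sum_if_const[OF assms, of "\<lambda>r. r \<in> A" 1]
    by (simp add: indicator_def of_bool_def)
qed

lemma sum_card_perp_swap: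
  fixes S T :: "(('a::{field,finite}) ^ 6) set set"
  assumes "S \<subseteq> quadric" "T \<subseteq> quadric"
  shows "(\<Sum>p\<in>S. real (card (perp p \<inter> T))) = (\<Sum>r\<in>T. real (card (perp r \<inter> S)))"
proof -
  have "(\<Sum>p\<in>S. real (card (perp p \<inter> T))) = (\<Sum>p\<in>S. \<Sum>r\<in>T. indicat_real (perp p) r)"
    by (simp add: card_Int_eq_sum)
  also have "\<dots> = (\<Sum>r\<in>T. \<Sum>p\<in>S. indicat_real (perp p) r)"
    by (rule sum.swap)
  also have "\<dots> = (\<Sum>r\<in>T. \<Sum>p\<in>S. indicat_real (perp r) p)"
    using assms by (intro sum.cong refl) (simp add: indicator_def subset_iff perp_commute)
  finally show ?thesis by (simp add: card_Int_eq_sum)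
qed

text \<open>After exchanging the order of counting, each point of \<open>T\<close> contributes q +
  1, and q^2 more if it lies on the generator.\<close>

lemma sum_card_perp_generator:
  fixes U :: "(('a::{field,finite}) ^ 6) set"
  assumes U: "totally_singular U" "vec.dim U = 3" and T: "T \<subseteq> quadric"
  shows "(\<Sum>p\<in>points_in U. real (card (perp p \<inter> T)))
    = (real CARD('a) + 1) * real (card T) + (real CARD('a))\<^sup>2 * real (card (points_in U \<inter> T))"
proof -
  have "(\<Sum>p\<in>points_in U. real (card (perp p \<inter> T)))
      = (\<Sum>r\<in>T. real CARD('a) + 1 + (real CARD('a))\<^sup>2 * indicator (points_in U) r)"
    using T points_in_totally_singular[OF U(1)] U
    by (subst sum_card_perp_swap) (auto intro!: sum.cong simp: card_perp_generator)
  also have "\<dots> = (real CARD('a) + 1) * real (card T)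
      + (real CARD('a))\<^sup>2 * (\<Sum>r\<in>T. indicator (points_in U) r)"
    by (simp only: sum.distrib sum_distrib_left sum_constant distrib_right) (simp only: ac_simps)
  also have "(\<Sum>r\<in>T. indicator (points_in U) r) = real (card (points_in U \<inter> T))"
    by (simp add: card_Int_eq_sum)
  finally show ?thesis .
qed

section \<open>Two disjoint generators\<close>

lemma span_quadric:
  assumes "totally_singular U" "u \<in> U" "u \<noteq> 0"
  shows "vec.span {u} \<in> points_in U" "vec.span {u} \<in> quadric"
proof -
  show "vec.span {u} \<in> points_in U"
    using assms span_in_pg_points[of u] vec.span_minimal[of "{u}" U]
    by (simp add: points_in_def totally_singular_def)
  then show "vec.span {u} \<in> quadric"
    using points_in_totally_singular[OF assms(1)] by blast
qed

lemma points_inE: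
  assumes "p \<in> points_in U"
  obtains u where "u \<in> U" "u \<noteq> 0" "p = vec.span {u}"
proof -
  obtain u where u: "u \<noteq> 0" "p = vec.span {u}"
    using assms by (auto simp: points_in_def elim: pg_pointE)
  moreover have "u \<in> U" using assms u vec.span_base[of u "{u}"] by (auto simp: points_in_def)
  ultimately show thesis using that by blast
qed

text \<open>Disjointness of the two planes is expressed on vectors. The assumptions are symmetric,
  so \<open>swapped\<close> gives every result with the two generators exchanged.\<close>

locale disjoint_generators =
  fixes U1 U2 :: "(('a::{field,finite}) ^ 6) set"
  assumes gen1: "totally_singular U1" "vec.dim U1 = 3"
    and gen2: "totally_singular U2" "vec.dim U2 = 3"
    and disj: "U1 \<inter> U2 = {0}"
begin

lemma swapped: "disjoint_generators U2 U1"
  using gen1 gen2 disj by (simp add: disjoint_generators_def Int_commute)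

lemma subspaces: "vec.subspace U1" "vec.subspace U2"
  using gen1 gen2 by (simp_all add: totally_singular_def)

lemma q_gt_1: "real CARD('a) > 1"
  using card_field_gt_1[where 'a='a] by simp

section \<open>The pairing between the two generators\<close>

lemma dim_insert_U2:
  assumes "u \<in> U1" "u \<noteq> 0"
  shows "vec.dim (insert u U2) = 4"
proof -
  have "u \<notin> U2" using assms disj by blast
  moreover have "vec.span U2 = U2" using subspaces by simp
  ultimately show ?thesis using gen2 by (simp add: vec.dim_insert del: vec.span_eq_iff)
qed

lemma dim_orth_insert_U2:
  assumes "u \<in> U1" "u \<noteq> 0"
  shows "vec.dim (orth (insert u U2)) = 2"
  using dim_insert_U2[OF assms] dim_orth[of "insert u U2"] by simp

lemma orth_insert_U2: "orth (insert u U2) = {v \<in> U2. polar_form u v = 0}"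
  using orth_insert[of u U2] orth_generator[OF gen2] by (auto simp: orth_def)

lemma orth_insert2_U2: "orth (insert u (insert v U2)) = {w \<in> U2. polar_form u w = 0 \<and> polar_form v w = 0}"
  using orth_insert[of u "insert v U2"] orth_insert_U2[of v] by (auto simp: orth_def)

lemma card_orth_U2:
  assumes "u \<in> U1" "u \<noteq> 0"
  shows "card {v \<in> U2. polar_form u v = 0} = CARD('a)\<^sup>2"
  using card_subspace[OF subspace_orth, of "insert u U2"] dim_orth_insert_U2[OF assms]
  unfolding orth_insert_U2 by simp

text \<open>Since \<open>U1\<close> meets \<open>U2\<close> trivially, independent vectors of
  \<open>U1\<close> stay independent modulo \<open>U2\<close>. Hence they generate a 5-space
  together with \<open>U2\<close>, whose complement has dimension 1.\<close>

lemma dim_orth_insert2_U2: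
  assumes a: "a \<in> U1" "a \<noteq> 0" and c: "c \<in> U1" "c \<notin> vec.span {a}"
  shows "vec.dim (orth (insert c (insert a U2))) = 1"
proof -
  have "c \<notin> vec.span (insert a U2)"
  proof
    assume "c \<in> vec.span (insert a U2)"
    then obtain k where "c - k *s a \<in> vec.span U2" by (auto simp: vec.span_insert)
    moreover have "vec.span U2 = U2" using subspaces by simp
    moreover have "c - k *s a \<in> U1"
      using a c subspaces by (simp add: vec.subspace_diff vec.subspace_scale)
    ultimately have "c - k *s a = 0" using disj by blast
    then have "c = k *s a" by simp
    then show False using c by (simp add: vec.span_scale vec.span_base)
  qed
  then have "vec.dim (insert c (insert a U2)) = 5"
    using dim_insert_U2[OF a] vec.dim_insert[of c "insert a U2"] by simp
  then show ?thesis using dim_orth[of "insert c (insert a U2)"] by simp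
qed

text \<open>Distinct points of the first plane determine distinct lines of the second, and these
  meet in one point. This supplies the off-diagonal entries of the incidence product in
  \<open>vanishing_on_generator\<close>.\<close>

lemma card_common_perp:
  assumes "p \<in> points_in U1" "r \<in> points_in U1" "p \<noteq> r"
  shows "card (perp p \<inter> perp r \<inter> points_in U2) = 1"
proof -
  obtain u where u: "u \<in> U1" "u \<noteq> 0" "p = vec.span {u}" using assms by (auto elim: points_inE)
  obtain v where v: "v \<in> U1" "v \<noteq> 0" "r = vec.span {v}" using assms by (auto elim: points_inE)
  have "v \<notin> vec.span {u}"
    using pg_point_eq_span[of p v] assms u v by (auto simp: span_in_pg_points)
  then have dim: "vec.dim (orth (insert v (insert u U2))) = 1"
    using u v by (intro dim_orth_insert2_U2)
  have "perp p \<inter> points_in U2 = points_in (orth (insert u U2))"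
    "perp r \<inter> points_in U2 = points_in (orth (insert v U2))"
    using u v span_quadric[OF gen1(1)] perp_Int_generator[OF gen2] by auto
  then have "perp p \<inter> perp r \<inter> points_in U2 = points_in (orth (insert u U2)) \<inter> points_in (orth (insert v U2))"
    by blast
  also have "\<dots> = points_in (orth (insert v (insert u U2)))"
    unfolding points_in_Int[symmetric] orth_insert_U2 orth_insert2_U2
    by (rule arg_cong[of _ _ points_in]) blast
  finally have "real (card (perp p \<inter> perp r \<inter> points_in U2)) = 1"
    using card_points_in_dim[of "orth (insert v (insert u U2))"] dim by simp
  then show ?thesis by simp
qed

lemma points_in_disjoint: "points_in U1 \<inter> points_in U2 = {}"
proof -
  have "False" if "p \<in> points_in U1" "p \<in> points_in U2" for p
    using that disj by (auto simp: points_in_def elim!: pg_pointE)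
      (metis IntI singletonD subsetD vec.span_base singletonI)
  then show ?thesis by blast
qed

text \<open>The plane joining a point of the first generator to the line of the second one
  that it is collinear with.\<close>

lemma transversal_plane:
  assumes "p \<in> points_in U1"
  obtains W where "totally_singular W" "vec.dim W = 3"
    "points_in W \<inter> points_in U1 = {p}" "points_in W \<inter> points_in U2 = perp p \<inter> points_in U2"
proof -
  obtain u where u: "u \<in> U1" "u \<noteq> 0" "p = vec.span {u}" using assms by (auto elim: points_inE)
  \<comment> \<open>\<open>L\<close> is the line of \<open>U2\<close> seen from p. It is totally
    singular and orthogonal to \<open>u\<close>, so joining \<open>u\<close> to it gives a totally
    singular plane.\<close>
  define L where "L = orth (insert u U2)"
  have L: "L = {v \<in> U2. polar_form u v = 0}" by (simp add: L_def orth_insert_U2)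
  have Lsub: "vec.subspace L" by (simp add: L_def)
  have Lspan: "vec.span L = L" using Lsub by simp
  have uL: "u \<notin> L" using u disj L by blast
  define W where "W = vec.span (insert u L)"
  have "totally_singular L" using L Lsub gen2 by (simp add: totally_singular_def)
  moreover have "u \<in> orth L" by (auto simp: L orth_def polar_form_commute)
  moreover have "hyperbolic_form u = 0" using gen1 u by (simp add: totally_singular_def)
  ultimately have W: "totally_singular W"
    unfolding W_def by (intro totally_singular_insert)
  have dim: "vec.dim W = 3"
    using dim_orth_insert_U2[OF u(1,2)] uL Lspan
    by (simp add: W_def L_def[symmetric] vec.dim_insert del: vec.span_eq_iff)
  have mem: "\<exists>k y. y \<in> L \<and> v = y + k *s u" if vW: "v \<in> W" for v
  proof -
    obtain k where "v - k *s u \<in> vec.span L"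
      using vW unfolding W_def vec.span_insert by blast
    then have "v - k *s u \<in> L" unfolding Lspan .
    then have "v - k *s u \<in> L \<and> v = (v - k *s u) + k *s u" by simp
    then show ?thesis by blast
  qed
  have sub: "L \<subseteq> W" "u \<in> W" unfolding W_def by (auto intro: vec.span_base)
  have pW: "p \<subseteq> W"
    using u sub vec.span_minimal[of "{u}" W] W by (simp add: totally_singular_def)
  have pU: "p \<subseteq> U1" using assms by (simp add: points_in_def)
  have "W \<inter> U1 = p"
  proof
    \<comment> \<open>Decompose v = y + k u with y in \<open>L\<close>. If v is in
      \<open>U1\<close>, then y lies in both generators and is 0; below, if v is in
      \<open>U2\<close>, then k u lies in both and is 0.\<close>
    show "W \<inter> U1 \<subseteq> p"
    proof
      fix v assume v: "v \<in> W \<inter> U1"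
      then obtain k y where ky: "y \<in> L" "v = y + k *s u" using mem by blast
      have "v - k *s u \<in> U1"
        using v u subspaces by (simp add: vec.subspace_diff vec.subspace_scale)
      then have "y \<in> U1" using ky by simp
      then have "y = 0" using ky L disj by blast
      then show "v \<in> p" using ky u by (simp add: vec.span_scale vec.span_base)
    qed
  qed (use pW pU in blast)
  then have "points_in W \<inter> points_in U1 = {p}"
    using points_in_pg_point[of p] u span_in_pg_points[of u] by (simp add: points_in_Int[symmetric])
  moreover have "W \<inter> U2 = L"
  proof
    show "W \<inter> U2 \<subseteq> L"
    proof
      fix v assume v: "v \<in> W \<inter> U2"
      then obtain k y where ky: "y \<in> L" "v = y + k *s u" using mem by blast
      have "v - y \<in> U2" using vec.subspace_diff[OF subspaces(2), of v y] v ky(1) L by blast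
      then have "k *s u \<in> U2" using ky by simp
      moreover have "k *s u \<in> U1" using u subspaces by (simp add: vec.subspace_scale)
      ultimately have "k *s u = 0" using disj by blast
      then show "v \<in> L" using ky by (simp only: add_0_right)
    qed
  qed (use sub L in blast)
  then have "points_in W \<inter> points_in U2 = perp p \<inter> points_in U2"
    using u span_quadric[OF gen1(1)] perp_Int_generator[OF gen2, of u]
    by (simp add: points_in_Int[symmetric] L_def)
  ultimately show thesis using that W dim by blast
qed

section \<open>Counting along the decomposition of the whole space as the direct sum of
  \<open>U1\<close> and \<open>U2\<close>\<close>

lemma decomposition: "bij_betw (\<lambda>(a, b). a + b) (U1 \<times> U2) UNIV"
proof -
  have inj: "inj_on (\<lambda>(a, b). a + b) (U1 \<times> U2)"
  proof (rule inj_onI, clarify)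
    fix a b c d assume abcd: "a \<in> U1" "b \<in> U2" "c \<in> U1" "d \<in> U2" and eq: "a + b = c + d"
    have "a - c = d - b" using eq by (simp add: algebra_simps)
    moreover have "a - c \<in> U1" "d - b \<in> U2" using abcd subspaces by (simp_all add: vec.subspace_diff)
    ultimately have "a - c = 0" using disj by (metis IntI singletonD)
    then show "a = c \<and> b = d" using eq by simp
  qed
  \<comment> \<open>Equal cardinalities, q^3 q^3 = q^6, upgrade injectivity to bijectivity.\<close>
  have "card (U1 \<times> U2) = card (UNIV :: ('a ^ 6) set)"
    using card_subspace[of U1] card_subspace[of U2] subspaces gen1 gen2
    by (simp add: card_cartesian_product power_add[symmetric])
  then have "(\<lambda>(a, b). a + b) ` (U1 \<times> U2) = UNIV"
    using inj by (intro card_subset_eq) (simp_all add: card_image)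
  then show ?thesis using inj by (simp add: bij_betw_def)
qed

lemma card_decomposition:
  "card {v. P v} = (\<Sum>c\<in>U1. card {d \<in> U2. P (c + d)})"
proof -
  have "bij_betw (\<lambda>(a, b). a + b) (SIGMA c:U1. {d \<in> U2. P (c + d)}) {v. P v}"
  proof (rule bij_betw_imageI)
    show "inj_on (\<lambda>(a, b). a + b) (SIGMA c:U1. {d \<in> U2. P (c + d)})"
      by (rule inj_on_subset[OF bij_betw_imp_inj_on[OF decomposition]]) auto
    have "v \<in> (\<lambda>(a, b). a + b) ` (SIGMA c:U1. {d \<in> U2. P (c + d)})" if "P v" for v
    proof -
      have "v \<in> (\<lambda>(a, b). a + b) ` (U1 \<times> U2)"
        using bij_betw_imp_surj_on[OF decomposition] by simp
      then show ?thesis using that by auto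
    qed
    then show "(\<lambda>(a, b). a + b) ` (SIGMA c:U1. {d \<in> U2. P (c + d)}) = {v. P v}" by auto
  qed
  then have "card {v. P v} = card (SIGMA c:U1. {d \<in> U2. P (c + d)})"
    by (simp add: bij_betw_same_card)
  then show ?thesis by simp
qed

text \<open>The quadratic terms vanish on the generators. For fixed \<open>c\<close> the remaining
  condition is linear in \<open>d\<close>, so the counts below reduce to linear fibres.\<close>

lemma hyperbolic_form_decomposition:
  assumes "c \<in> U1" "d \<in> U2"
  shows "hyperbolic_form (c + d) = polar_form c d"
  using assms gen1 gen2 by (simp add: hyperbolic_form_add totally_singular_def)

lemma card_quadric:
  "real (card (quadric :: ('a ^ 6) set set))
    = ((real CARD('a))\<^sup>2 + 1) * ((real CARD('a))\<^sup>2 + real CARD('a) + 1)"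
proof -
  let ?q = "real CARD('a)"
  let ?S = "{v :: 'a ^ 6. hyperbolic_form v = 0}"
  have le: "CARD('a)\<^sup>2 \<le> CARD('a) ^ 3"
    using card_field_gt_1[where 'a='a] by (intro power_increasing) auto
  have "card ?S = (\<Sum>c\<in>U1. card {d \<in> U2. hyperbolic_form (c + d) = 0})"
    by (rule card_decomposition)
  \<comment> \<open>A nonzero \<open>c\<close> leaves a hyperplane of \<open>U2\<close>, with q^2
    vectors; \<open>c = 0\<close> leaves all q^3, whence the surplus.\<close>
  also have "\<dots> = (\<Sum>c\<in>U1. CARD('a)\<^sup>2 + (if c = 0 then CARD('a) ^ 3 - CARD('a)\<^sup>2 else 0))"
  proof (rule sum.cong)
    fix c assume c: "c \<in> U1"
    have "{d \<in> U2. hyperbolic_form (c + d) = 0} = {d \<in> U2. polar_form c d = 0}"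
      using c by (auto simp: hyperbolic_form_decomposition)
    then show "card {d \<in> U2. hyperbolic_form (c + d) = 0}
        = CARD('a)\<^sup>2 + (if c = 0 then CARD('a) ^ 3 - CARD('a)\<^sup>2 else 0)"
      using c card_subspace[of U2] subspaces gen2 le
      by (cases "c = 0") (simp_all add: polar_form_simps card_orth_U2)
  qed simp
  also have "\<dots> = CARD('a) ^ 3 * CARD('a)\<^sup>2 + (CARD('a) ^ 3 - CARD('a)\<^sup>2)"
    using card_subspace[of U1] subspaces gen1 by (simp add: sum.distrib vec.subspace_0)
  finally have "real (card ?S) = ?q ^ 3 * ?q\<^sup>2 + (?q ^ 3 - ?q\<^sup>2)"
    by (simp only: of_nat_add of_nat_mult of_nat_power of_nat_diff[OF le])
  then have "(?q - 1) * real (card (quadric :: ('a ^ 6) set set)) = ?q ^ 3 * ?q\<^sup>2 + (?q ^ 3 - ?q\<^sup>2) - 1"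
    using card_points_in[of ?S] by (simp add: quadric_eq hyperbolic_form_scale)
  also have "\<dots> = (?q - 1) * ((?q\<^sup>2 + 1) * (?q\<^sup>2 + ?q + 1))"
    by (simp add: power2_eq_square power3_eq_cube algebra_simps)
  finally show ?thesis using q_gt_1 by simp
qed

text \<open>Write the point as spanned by a + b. A vector c + d is singular and orthogonal to it iff
  B(c, d) = 0 and B(a, d) = -B(b, c). For c in the span of a these amount to one condition on d,
  leaving q^2 solutions; otherwise they are two independent conditions, leaving q.\<close>

lemma card_perp:
  assumes p: "p \<in> quadric - (points_in U1 \<union> points_in U2)"
  shows "real (card (perp p)) = real CARD('a) * (real CARD('a) + 1)\<^sup>2 + 1"
proof -
  let ?q = "real CARD('a)"
  obtain w where w: "w \<noteq> 0" "p = vec.span {w}" using p by (metis DiffD1 quadric_pg_points pg_pointE)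
  have wp: "w \<in> p" using w by (simp add: vec.span_base)
  have "w \<in> (\<lambda>(a, b). a + b) ` (U1 \<times> U2)"
    using bij_betw_imp_surj_on[OF decomposition] by simp
  then obtain a b where ab: "a \<in> U1" "b \<in> U2" "w = a + b" by auto
  have wq: "hyperbolic_form w = 0" using p wp by (simp add: quadric_def)
  \<comment> \<open>Otherwise p would be spanned by \<open>b\<close> and lie on the second
    generator.\<close>
  have "a \<noteq> 0"
    using p w ab span_quadric[OF gen2(1), of b] by auto
  have pab: "polar_form a b = 0" using wq ab hyperbolic_form_decomposition by simp
  let ?S = "{v. hyperbolic_form v = 0 \<and> polar_form w v = 0}"
  have fib: "card {d \<in> U2. hyperbolic_form (c + d) = 0 \<and> polar_form w (c + d) = 0}
      = CARD('a) + (if c \<in> vec.span {a} then CARD('a)\<^sup>2 - CARD('a) else 0)" if c: "c \<in> U1" for c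
  proof -
    have "polar_form a c = 0" "polar_form b d = 0" if "d \<in> U2" for d
      using totally_singular_subset_orth[OF gen1(1)] totally_singular_subset_orth[OF gen2(1)] ab c that
      by (auto simp: orth_def)
    then have eq: "{d \<in> U2. hyperbolic_form (c + d) = 0 \<and> polar_form w (c + d) = 0}
        = {d \<in> U2. polar_form c d = 0 \<and> polar_form a d = - polar_form b c}"
      using c ab by (auto simp: hyperbolic_form_decomposition polar_form_simps add_eq_0_iff2 add_eq_0_iff)
    have le: "CARD('a) \<le> CARD('a)\<^sup>2" by (simp add: power2_eq_square)
    have ca: "card {d \<in> U2. polar_form a d = 0} = CARD('a)\<^sup>2"
      using ab \<open>a \<noteq> 0\<close> by (intro card_orth_U2)
    show ?thesis
    proof (cases "c \<in> vec.span {a}")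
      case True
      then obtain k where "c = k *s a" by (auto simp: vec.span_singleton)
      then have "{d \<in> U2. polar_form c d = 0 \<and> polar_form a d = - polar_form b c}
          = {d \<in> U2. polar_form a d = 0}"
        using pab by (auto simp: polar_form_simps polar_form_commute[of b a])
      then show ?thesis using eq ca le True by simp
    next
      case False
      then have "c \<noteq> 0" by (auto simp: vec.span_zero)
      have D: "orth (insert c U2) = {d \<in> U2. polar_form c d = 0}" by (rule orth_insert_U2)
      have cD: "card {d \<in> U2. polar_form c d = 0} = CARD('a)\<^sup>2"
        using c \<open>c \<noteq> 0\<close> by (intro card_orth_U2)
      have "card {d \<in> U2. polar_form c d = 0 \<and> polar_form a d = 0} = CARD('a)"
        using card_subspace[OF subspace_orth, of "insert c (insert a U2)"]
          dim_orth_insert2_U2[OF ab(1) \<open>a \<noteq> 0\<close> c False]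
        unfolding orth_insert2_U2 by simp
      \<comment> \<open>The sizes q and q^2 differ, so B(a, _) is not identically zero on the kernel
        of B(c, _), and its fibres there all have q elements.\<close>
      then have "{d \<in> U2. polar_form c d = 0 \<and> polar_form a d = 0} \<noteq> {d \<in> U2. polar_form c d = 0}"
        using cD card_field_gt_1[where 'a='a] by (auto simp: power2_eq_square)
      then obtain u where "u \<in> U2" "polar_form c u = 0" "polar_form a u \<noteq> 0" by blast
      moreover have "vec.subspace {d \<in> U2. polar_form c d = 0}"
        using subspace_orth[of "insert c U2"] by (simp add: D)
      ultimately have "CARD('a) * card {d \<in> {d \<in> U2. polar_form c d = 0}. polar_form a d = - polar_form b c}
          = card {d \<in> U2. polar_form c d = 0}"
        by (intro card_linear_fibre[where u = u]) (simp_all add: polar_form_simps)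
      then have "card {d \<in> U2. polar_form c d = 0 \<and> polar_form a d = - polar_form b c} = CARD('a)"
        by (simp add: cD conj_assoc power2_eq_square)
      then show ?thesis using eq False by simp
    qed
  qed
  have asub: "vec.span {a} \<subseteq> U1" using ab subspaces vec.span_minimal[of "{a}" U1] by simp
  have acard: "card (vec.span {a}) = CARD('a)"
    using card_subspace[of "vec.span {a}"] \<open>a \<noteq> 0\<close> by simp
  have "card ?S = (\<Sum>c\<in>U1. card {d \<in> U2. hyperbolic_form (c + d) = 0 \<and> polar_form w (c + d) = 0})"
    by (rule card_decomposition)
  also have "\<dots> = (\<Sum>c\<in>U1. CARD('a) + (if c \<in> vec.span {a} then CARD('a)\<^sup>2 - CARD('a) else 0))"
    using fib by (intro sum.cong) auto
  also have "\<dots> = CARD('a) ^ 3 * CARD('a) + (\<Sum>c\<in>U1. if c \<in> vec.span {a} then CARD('a)\<^sup>2 - CARD('a) else 0)"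
    using card_subspace[of U1] subspaces gen1 by (simp add: sum.distrib)
  also have "(\<Sum>c\<in>U1. if c \<in> vec.span {a} then CARD('a)\<^sup>2 - CARD('a) else 0)
      = (\<Sum>c\<in>vec.span {a}. CARD('a)\<^sup>2 - CARD('a))"
    using asub by (subst sum.inter_restrict[symmetric]) (auto simp: Int_absorb1)
  finally have "card ?S = CARD('a) ^ 3 * CARD('a) + CARD('a) * (CARD('a)\<^sup>2 - CARD('a))"
    by (simp add: acard)
  then have "real (card ?S) = ?q ^ 3 * ?q + ?q * (?q\<^sup>2 - ?q)"
    by (simp add: of_nat_diff power2_eq_square)
  moreover have "perp p = points_in ?S"
  proof -
    have "orth p = {v. polar_form w v = 0}" using w by (simp add: orth_def[of "{w}"])
    then have "?S = {v. hyperbolic_form v = 0} \<inter> orth p" by auto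
    then show ?thesis using p by (simp add: perp_eq quadric_eq points_in_Int)
  qed
  ultimately have "(?q - 1) * real (card (perp p)) = ?q ^ 3 * ?q + ?q * (?q\<^sup>2 - ?q) - 1"
    using card_points_in[of ?S] by (simp add: hyperbolic_form_scale polar_form_simps)
  also have "\<dots> = (?q - 1) * (?q * (?q + 1)\<^sup>2 + 1)"
    by (simp add: power2_eq_square power3_eq_cube algebra_simps)
  finally show ?thesis using q_gt_1 by simp
qed

lemma card_points_in_U:
  "real (card (points_in U1)) = (real CARD('a))\<^sup>2 + real CARD('a) + 1"
  "real (card (points_in U2)) = (real CARD('a))\<^sup>2 + real CARD('a) + 1"
  using card_points_in_dim[of U1] card_points_in_dim[of U2] subspaces gen1 gen2
  by (simp_all add: numeral_2_eq_2 numeral_3_eq_3)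

lemma card_remaining_points:
  "real (card (quadric - (points_in U1 \<union> points_in U2)))
    = ((real CARD('a))\<^sup>2 - 1) * ((real CARD('a))\<^sup>2 + real CARD('a) + 1)"
proof -
  let ?q = "real CARD('a)"
  have sub: "points_in U1 \<union> points_in U2 \<subseteq> quadric"
    using points_in_totally_singular[OF gen1(1)] points_in_totally_singular[OF gen2(1)] by simp
  have "card (points_in U1 \<union> points_in U2) = card (points_in U1) + card (points_in U2)"
    using points_in_disjoint by (intro card_Un_disjoint) auto
  then have "real (card (quadric - (points_in U1 \<union> points_in U2)))
      = (?q\<^sup>2 + 1) * (?q\<^sup>2 + ?q + 1) - 2 * (?q\<^sup>2 + ?q + 1)"
    using sub card_quadric card_points_in_U card_mono[OF _ sub]
    by (simp add: card_Diff_subset of_nat_diff)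
  then show ?thesis by (simp add: algebra_simps)
qed

text \<open>Remove from the perp its two disjoint lines of q + 1 points in the generators. The final
  1 counts \<open>p\<close> itself; without it this is the row sum of the reduced collinearity
  matrix.\<close>

lemma card_perp_remaining_points:
  assumes p: "p \<in> quadric - (points_in U1 \<union> points_in U2)"
  shows "real (card (perp p \<inter> (quadric - (points_in U1 \<union> points_in U2))))
    = ((real CARD('a))\<^sup>2 - 1) * (real CARD('a) + 2) + 1"
proof -
  let ?q = "real CARD('a)"
  let ?X = "perp p \<inter> points_in U1 \<union> perp p \<inter> points_in U2"
  have eq: "perp p \<inter> (quadric - (points_in U1 \<union> points_in U2)) = perp p - ?X"
    using p by (auto simp: perp_eq)
  have sub: "?X \<subseteq> perp p" by blast
  have "card ?X = card (perp p \<inter> points_in U1) + card (perp p \<inter> points_in U2)"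
    using points_in_disjoint by (intro card_Un_disjoint) auto
  then have "real (card ?X) = 2 * (?q + 1)"
    using card_perp_generator[OF gen1, of p] card_perp_generator[OF gen2, of p] p by simp
  moreover have "real (card (perp p - ?X)) = real (card (perp p)) - real (card ?X)"
    using card_mono[OF _ sub] by (subst card_Diff_subset[OF _ sub]) (simp_all add: of_nat_diff)
  ultimately have "real (card (perp p - ?X)) = ?q * (?q + 1)\<^sup>2 + 1 - 2 * (?q + 1)"
    using card_perp[OF p] by simp
  then show ?thesis unfolding eq by (simp add: power2_eq_square algebra_simps)
qed

section \<open>Functions supported on the two generators that sum to zero on every generator\<close>

lemma sum_transversal:
  fixes w :: "('a ^ 6) set \<Rightarrow> real"
  assumes w0: "\<And>p. p \<in> quadric - (points_in U1 \<union> points_in U2) \<Longrightarrow> w p = 0"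
    and ws: "\<And>W. totally_singular W \<Longrightarrow> vec.dim W = 3 \<Longrightarrow> sum w (points_in W) = 0"
    and p: "p \<in> points_in U1"
  shows "w p = - (\<Sum>r\<in>points_in U2. indicator (perp p) r * w r)"
proof -
  obtain W where W: "totally_singular W" "vec.dim W = 3"
    "points_in W \<inter> points_in U1 = {p}" "points_in W \<inter> points_in U2 = perp p \<inter> points_in U2"
    using transversal_plane[OF p] .
  \<comment> \<open>Any other point of the transversal plane lies off both generators, where
    \<open>w\<close> is zero.\<close>
  have "sum w (points_in W) = sum w ({p} \<union> (perp p \<inter> points_in U2))"
  proof (rule sum.mono_neutral_right)
    show "\<forall>r\<in>points_in W - ({p} \<union> (perp p \<inter> points_in U2)). w r = 0"
      using W points_in_totally_singular[OF W(1)] by (intro ballI w0) blast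
  qed (use W in auto)
  also have "\<dots> = w p + sum w (perp p \<inter> points_in U2)"
    using p points_in_disjoint by (subst sum.union_disjoint) auto
  also have "sum w (perp p \<inter> points_in U2) = (\<Sum>r\<in>points_in U2. indicator (perp p) r * w r)"
    by (subst Int_commute) (simp add: sum.inter_restrict indicator_def if_distrib cong: if_cong)
  finally show ?thesis using ws W by simp
qed

text \<open>Applying \<open>sum_transversal\<close> twice gives \<open>w = M M\<^sup>T w\<close> on the first generator, where \<open>M\<close> is
  the collinearity matrix between the two generators. It is a point-line incidence matrix of a
  projective plane, so \<open>M M\<^sup>T = q I + J\<close>.\<close>

lemma vanishing_on_generator:
  fixes w :: "('a ^ 6) set \<Rightarrow> real"
  assumes w0: "\<And>p. p \<in> quadric - (points_in U1 \<union> points_in U2) \<Longrightarrow> w p = 0"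
    and ws: "\<And>W. totally_singular W \<Longrightarrow> vec.dim W = 3 \<Longrightarrow> sum w (points_in W) = 0"
    and p: "p \<in> points_in U1"
  shows "w p = 0"
proof -
  let ?q = "real CARD('a)"
  interpret sw: disjoint_generators U2 U1 by (rule swapped)
  have quad: "points_in U1 \<subseteq> quadric" "points_in U2 \<subseteq> quadric"
    using points_in_totally_singular gen1 gen2 by blast+
  have w_second: "w r = - (\<Sum>s\<in>points_in U1. indicator (perp r) s * w s)" if "r \<in> points_in U2" for r
    using w0[unfolded Un_commute[of "points_in U1"]] ws that by (rule sw.sum_transversal)
  have incidence: "(\<Sum>r\<in>points_in U2. indicator (perp p) r * indicator (perp s) r) =
      1 + (if s = p then ?q else 0)" if s: "s \<in> points_in U1" for s
  proof -
    have "(\<Sum>r\<in>points_in U2. indicator (perp p) r * indicator (perp s) r)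
        = real (card (perp p \<inter> perp s \<inter> points_in U2))"
      by (simp only: card_Int_eq_sum[OF finite] indicator_inter_arith)
    moreover have "p \<in> quadric" "p \<notin> points_in U2" using p quad points_in_disjoint by blast+
    then have "real (card (perp p \<inter> points_in U2)) = ?q + 1"
      using card_perp_generator[OF gen2, of p] by simp
    ultimately show ?thesis using card_common_perp[OF p s] by auto
  qed
  have "w p = - (\<Sum>r\<in>points_in U2. indicator (perp p) r * w r)"
    using w0 ws p by (rule sum_transversal)
  \<comment> \<open>Inserting the exchanged identity for the points of the second generator makes
    the two minus signs cancel.\<close>
  also have "\<dots> = (\<Sum>r\<in>points_in U2. \<Sum>s\<in>points_in U1. indicator (perp p) r * indicator (perp r) s * w s)"
    unfolding sum_negf[symmetric]
  proof (intro sum.cong refl)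
    fix r assume r: "r \<in> points_in U2"
    show "- (indicator (perp p) r * w r)
        = (\<Sum>s\<in>points_in U1. indicator (perp p) r * indicator (perp r) s * w s)"
      unfolding w_second[OF r] by (simp only: mult_minus_right minus_minus sum_distrib_left mult.assoc)
  qed
  also have "\<dots> = (\<Sum>r\<in>points_in U2. \<Sum>s\<in>points_in U1. indicator (perp p) r * indicator (perp s) r * w s)"
  proof (intro sum.cong refl)
    fix r s assume "r \<in> points_in U2" "s \<in> points_in U1"
    then have "s \<in> perp r \<longleftrightarrow> r \<in> perp s" using quad by (intro perp_commute) auto
    then show "indicator (perp p) r * indicator (perp r) s * w s
        = indicator (perp p) r * indicator (perp s) r * w s" by (simp add: indicator_def)
  qed
  also have "\<dots> = (\<Sum>s\<in>points_in U1. (\<Sum>r\<in>points_in U2. indicator (perp p) r * indicator (perp s) r) * w s)"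
    by (subst sum.swap) (simp only: sum_distrib_right)
  also have "\<dots> = (\<Sum>s\<in>points_in U1. w s + (if s = p then ?q * w s else 0))"
  proof (intro sum.cong refl)
    fix s assume s: "s \<in> points_in U1"
    show "(\<Sum>r\<in>points_in U2. indicator (perp p) r * indicator (perp s) r) * w s
        = w s + (if s = p then ?q * w s else 0)"
      unfolding incidence[OF s] by (simp add: algebra_simps)
  qed
  \<comment> \<open>The all-ones part contributes the sum of \<open>w\<close> over the first
    generator, which is zero. Since q > 1, the resulting \<open>w p = ?q * w p\<close> forces
    \<open>w p = 0\<close>.\<close>
  also have "\<dots> = ?q * w p"
    using ws[OF gen1] p by (simp add: sum.distrib)
  finally show ?thesis using q_gt_1 by simp
qed

section \<open>From the points off the generators to tightness, and the link with the eigenvector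
  equation\<close>

lemma tight_set_if_remaining_points:
  assumes T: "T \<subseteq> quadric - (points_in U1 \<union> points_in U2)"
    and t: "\<And>p. p \<in> quadric - (points_in U1 \<union> points_in U2) \<Longrightarrow>
      real (card (perp p \<inter> T)) = x * (real CARD('a) + 1) + (real CARD('a))\<^sup>2 * indicator T p"
  shows "tight_set x T"
proof -
  let ?q = "real CARD('a)"
  interpret sw: disjoint_generators U2 U1 by (rule swapped)
  let ?I = "quadric - (points_in U1 \<union> points_in U2)"
  have TQ: "T \<subseteq> quadric" using T by blast
  have "(\<Sum>p\<in>?I. real (card (perp p \<inter> T))) = (\<Sum>p\<in>?I. x * (?q + 1) + ?q\<^sup>2 * indicator T p)"
    using t by (intro sum.cong refl)
  also have "\<dots> = real (card ?I) * (x * (?q + 1)) + ?q\<^sup>2 * real (card (T \<inter> ?I))"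
    unfolding sum.distrib sum_constant card_Int_eq_sum[OF finite] sum_distrib_left ..
  also have "T \<inter> ?I = T" using T by blast
  finally have 1: "(\<Sum>p\<in>?I. real (card (perp p \<inter> T)))
      = (?q\<^sup>2 - 1) * (?q\<^sup>2 + ?q + 1) * (x * (?q + 1)) + ?q\<^sup>2 * real (card T)"
    by (simp only: card_remaining_points)
  have "(\<Sum>p\<in>?I. real (card (perp p \<inter> T))) = (\<Sum>r\<in>T. real (card (perp r \<inter> ?I)))"
    using TQ by (intro sum_card_perp_swap) auto
  also have "\<dots> = (\<Sum>r\<in>T. (?q\<^sup>2 - 1) * (?q + 2) + 1)"
    using T by (intro sum.cong refl card_perp_remaining_points) auto
  finally have 2: "(\<Sum>p\<in>?I. real (card (perp p \<inter> T))) = real (card T) * ((?q\<^sup>2 - 1) * (?q + 2) + 1)"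
    by simp
  \<comment> \<open>Equating the two counts, the coefficient of |T| is (q^2 - 1)(q + 2) + 1 - q^2 =
    (q^2 - 1)(q + 1), which is nonzero and can be cancelled.\<close>
  have "(?q\<^sup>2 - 1) * (?q + 1) * real (card T) = real (card T) * ((?q\<^sup>2 - 1) * (?q + 2) + 1) - ?q\<^sup>2 * real (card T)"
    by (simp add: algebra_simps)
  also have "\<dots> = (?q\<^sup>2 - 1) * (?q + 1) * (x * (?q\<^sup>2 + ?q + 1))"
    using 1 2 by (simp add: mult_ac)
  finally have cardT: "real (card T) = x * (?q\<^sup>2 + ?q + 1)"
    using q_gt_1 by (simp add: power2_eq_1_iff)
  define w where "w p = real (card (perp p \<inter> T)) - ?q\<^sup>2 * indicator T p - x * (?q + 1)" for p
  have w0: "w p = 0" if "p \<in> ?I" for p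
    using t[OF that] by (simp add: w_def)
  have ws: "sum w (points_in W) = 0" if W: "totally_singular W" "vec.dim W = 3" for W
  proof -
    have cardW: "real (card (points_in W)) = ?q\<^sup>2 + ?q + 1"
      using card_points_in_dim[of W] W
      by (simp add: totally_singular_def numeral_2_eq_2 numeral_3_eq_3)
    have "sum w (points_in W) = (\<Sum>p\<in>points_in W.
        real (card (perp p \<inter> T)) - ?q\<^sup>2 * indicator T p - x * (?q + 1))"
      by (intro sum.cong refl w_def)
    also have "\<dots> = (\<Sum>p\<in>points_in W. real (card (perp p \<inter> T)))
        - ?q\<^sup>2 * real (card (T \<inter> points_in W)) - real (card (points_in W)) * (x * (?q + 1))"
      unfolding sum_subtractf sum_constant card_Int_eq_sum[OF finite, of T "points_in W"]
        sum_distrib_left ..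
    \<comment> \<open>The q^2 terms counting the points of \<open>T\<close> on the plane cancel, so
      only |T| enters and its known value gives zero.\<close>
    also have "\<dots> = (?q + 1) * real (card T) - (?q\<^sup>2 + ?q + 1) * (x * (?q + 1))"
      unfolding sum_card_perp_generator[OF W TQ] cardW by (simp add: Int_commute)
    finally show ?thesis by (simp add: cardT)
  qed
  have w1: "w p = 0" if "p \<in> points_in U1" for p
    using w0 ws that by (rule vanishing_on_generator)
  have w2: "w p = 0" if "p \<in> points_in U2" for p
    using w0[unfolded Un_commute[of "points_in U1"]] ws that by (rule sw.vanishing_on_generator)
  have "w p = 0" if "p \<in> quadric" for p
    using w0 w1 w2 that by blast
  then show ?thesis
    using TQ by (simp add: tight_set_def w_def algebra_simps)
qed

text \<open>Row sums turn the multiple of the all-ones vector into x(q + 2), so with t the indicator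
  of \<open>T\<close> at p the equation at p reads |perp p \<inter> T| - t - x(q + 2) = (q^2 - 1) t
  - x, a rearrangement of the tightness condition at p.\<close>

lemma eigenvector_iff_remaining_points:
  fixes T :: "('a ^ 6) set set" and x :: real
  defines "I \<equiv> quadric - (points_in U1 \<union> points_in U2)"
  defines "v \<equiv> vec_diff I (restrict (char_vec T) I)
    (vec_scale I (x / ((real CARD('a))\<^sup>2 - 1)) (all_ones I))"
  assumes T: "T \<subseteq> I"
  shows "row_mult I v (restrict_matrix I collinearity_matrix)
      = vec_scale I ((real CARD('a))\<^sup>2 - 1) v \<longleftrightarrow>
    (\<forall>p\<in>I. real (card (perp p \<inter> T))
      = x * (real CARD('a) + 1) + (real CARD('a))\<^sup>2 * indicator T p)"
proof -
  let ?q = "real CARD('a)"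
  define c where "c = x / (?q\<^sup>2 - 1)"
  have "?q\<^sup>2 - 1 \<noteq> 0" using q_gt_1 by (simp add: power2_eq_1_iff)
  then have cx: "c * (?q\<^sup>2 - 1) = x" by (simp add: c_def)
  have v: "v i = indicator T i - c" if "i \<in> I" for i
    using that by (simp add: v_def vec_diff_def vec_scale_def all_ones_def char_vec_def c_def I_def)
  \<comment> \<open>The perp contains its own point while the matrix has zero diagonal; the
    subtracted singleton corrects this.\<close>
  have A: "restrict_matrix I collinearity_matrix i p = indicator (perp p) i - indicator {p} i"
    if ip: "i \<in> I" "p \<in> I" for i p
  proof -
    have iq: "i \<in> quadric" "p \<in> quadric" using ip by (auto simp: I_def)
    have "p \<in> perp i \<longleftrightarrow> p = i \<or> on_common_line i p" using iq by (auto simp: perp_def)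
    then have "i \<in> perp p \<longleftrightarrow> p = i \<or> on_common_line i p" using perp_commute iq by blast
    then show ?thesis
      using ip iq by (auto simp: restrict_matrix_def collinearity_matrix_def indicator_def)
  qed
  have row: "(\<Sum>i\<in>I. v i * restrict_matrix I collinearity_matrix i p)
      = real (card (perp p \<inter> T)) - indicator T p - x * (?q + 2)" if p: "p \<in> I" for p
  proof -
    have "(\<Sum>i\<in>I. v i * restrict_matrix I collinearity_matrix i p)
        = (\<Sum>i\<in>I. indicator (perp p \<inter> T) i - c * indicator (perp p) i
             - (if i = p then indicator T i - c else 0))"
      using p by (intro sum.cong refl) (auto simp: v A indicator_def)
    also have "\<dots> = real (card (perp p \<inter> T \<inter> I)) - c * real (card (perp p \<inter> I)) - (indicator T p - c)"
      using p by (simp only: sum_subtractf sum_distrib_left[symmetric] card_Int_eq_sum[OF finite]) simp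
    also have "perp p \<inter> T \<inter> I = perp p \<inter> T" using T by blast
    also have "real (card (perp p \<inter> I)) = (?q\<^sup>2 - 1) * (?q + 2) + 1"
      using card_perp_remaining_points[of p] p by (simp add: I_def)
    also have "c * ((?q\<^sup>2 - 1) * (?q + 2) + 1) = x * (?q + 2) + c"
      unfolding cx[symmetric] by (simp add: algebra_simps)
    finally show ?thesis by simp
  qed
  \<comment> \<open>Both sides are extensional on \<open>I\<close>, so equality of functions is
    equality at the points of \<open>I\<close>.\<close>
  have "row_mult I v (restrict_matrix I collinearity_matrix) = vec_scale I (?q\<^sup>2 - 1) v \<longleftrightarrow>
      (\<forall>p\<in>I. (\<Sum>i\<in>I. v i * restrict_matrix I collinearity_matrix i p) = (?q\<^sup>2 - 1) * v p)"
    unfolding row_mult_def vec_scale_def by (auto simp: fun_eq_iff restrict_def)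
  also have "\<dots> \<longleftrightarrow> (\<forall>p\<in>I. real (card (perp p \<inter> T)) = x * (?q + 1) + ?q\<^sup>2 * indicator T p)"
  proof (intro ball_cong refl)
    fix p assume p: "p \<in> I"
    have "(?q\<^sup>2 - 1) * v p = (?q\<^sup>2 - 1) * indicator T p - x"
      unfolding cx[symmetric] by (simp add: v[OF p] algebra_simps)
    then show "(\<Sum>i\<in>I. v i * restrict_matrix I collinearity_matrix i p) = (?q\<^sup>2 - 1) * v p \<longleftrightarrow>
        real (card (perp p \<inter> T)) = x * (?q + 1) + ?q\<^sup>2 * indicator T p"
      unfolding row[OF p] by (simp add: algebra_simps) argo
  qed
  finally show ?thesis .
qed

end

theorem mainTheorem5:
  fixes \<pi>1 \<pi>2 T :: "(('a::{field,finite}) ^ 6) set set" and x :: real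
  assumes "\<pi>1 \<in> generators" and "\<pi>2 \<in> generators" and "\<pi>1 \<inter> \<pi>2 = {}"
    and "T \<subseteq> quadric" and "T \<inter> (\<pi>1 \<union> \<pi>2) = {}"
  shows "tight_set x T \<longleftrightarrow>
    (let q = real CARD('a);
         I = quadric - (\<pi>1 \<union> \<pi>2);
         c' = restrict (char_vec T) I;
         A' = restrict_matrix I collinearity_matrix;
         j' = all_ones I;
         v = vec_diff I c' (vec_scale I (x / (q\<^sup>2 - 1)) j')
     in row_mult I v A' = vec_scale I (q\<^sup>2 - 1) v)"
proof -
  obtain U1 where U1: "totally_singular U1" "vec.dim U1 = 3" "\<pi>1 = points_in U1"
    using assms(1) by (rule generatorE)
  obtain U2 where U2: "totally_singular U2" "vec.dim U2 = 3" "\<pi>2 = points_in U2"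
    using assms(2) by (rule generatorE)
  \<comment> \<open>A nonzero common vector would span a common point of the two planes.\<close>
  have "u = 0" if "u \<in> U1" "u \<in> U2" for u
    using that span_quadric(1)[OF U1(1), of u] span_quadric(1)[OF U2(1), of u] assms(3) U1(3) U2(3)
    by blast
  moreover have "0 \<in> U1" "0 \<in> U2"
    using U1 U2 by (simp_all add: totally_singular_def vec.subspace_0)
  ultimately have "U1 \<inter> U2 = {0}" by blast
  then interpret disjoint_generators U1 U2
    using U1 U2 by unfold_locales auto
  have T: "T \<subseteq> quadric - (points_in U1 \<union> points_in U2)"
    using assms U1 U2 by blast
  show ?thesis
    unfolding Let_def U1(3) U2(3) eigenvector_iff_remaining_points[OF T]
    using tight_set_if_remaining_points[OF T, of x] by (auto simp: tight_set_def)
qed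

end
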